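(* Let $a \in \mathbb{R}$. Then $$\lim_{n \to \infty} \frac{1}{q^n} \left| \left\{ f \in M_n \ \Big| \ \frac{\omega_1(f) - \log n}{\sqrt{\log n}} \leq a \right\} \right| = \Phi(a),$$ where $\Phi(a) = \frac{1}{\sqrt{2\pi}} \int_{-\infty}^{a} e^{-\frac{u^2}{2}}\, du$.
   Context: $\mathbb{F}_q$ is the finite field with $q$ elements ($q$ a fixed prime power), and $\mathbb{F}_q[t]$ is its polynomial ring. For $n \ge 1$, $M_n$ is the set of monic polynomials of degree $n$ in $\mathbb{F}_q[t]$. For a monic polynomial $f$ of degree $\ge 1$, $\omega_1(f)$ is the number of monic irreducible polynomials $l \in \mathbb{F}_q[t]$ with $l \mid f$ and $l^2 \nmid f$. $|\{\cdot\}|$ denotes cardinality. *)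

theory Defs
  imports "HOL-Analysis.Analysis" "HOL-Computational_Algebra.Computational_Algebra"
begin

text \<open>The finite field with \<open>q\<close> elements is a type of sort \<open>{field, finite}\<close>; \<open>q\<close> is its
  cardinality.\<close>

definition monic_polys :: "nat \<Rightarrow> 'a::{field, finite} poly set" where
  "monic_polys n = {f. lead_coeff f = 1 \<and> degree f = n}"

text \<open>For \<open>f = 0\<close> the set below is empty, since \<open>l\<^sup>2\<close> divides \<open>0\<close>; for \<open>f \<noteq> 0\<close> it is finite.\<close>

definition omega1 :: "'a::{field, finite} poly \<Rightarrow> nat" where
  "omega1 f = card {l. lead_coeff l = 1 \<and> irreducible l \<and> l dvd f \<and> \<not> l ^ 2 dvd f}"

definition std_normal_cdf :: "real \<Rightarrow> real" where
  "std_normal_cdf a = 1 / sqrt (2 * pi) * (LBINT u:{..a}. exp (- (u\<^sup>2 / 2)))"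

end

theory Submission
  imports Defs "HOL-Probability.Probability" "HOL-Real_Asymp.Real_Asymp"
begin

text \<open>
  The proof computes characteristic functions. Let \<open>q\<close> be the cardinality of the field, \<open>M_n\<close> the set
  of monic polynomials of degree \<open>n\<close>, and let \<open>f\<close> be uniformly distributed in \<open>M_n\<close>. For \<open>norm z = 1\<close>
  the power \<open>z ^ omega1 f\<close> is a product of local factors over the monic irreducibles \<open>l\<close> of degree at
  most \<open>n\<close>, namely \<open>1 + (z - 1) * ([l dvd f] - [l\<^sup>2 dvd f])\<close>.

  Only the irreducibles of degree at most \<open>k = n / ln n\<close> matter: those of larger degree change the mean
  by at most \<open>norm (z - 1) * ln (n / k)\<close> (\<open>large_irreducibles_negligible\<close>). For the remaining ones, the
  divisibility conditions are independent up to an error that comes from divisors of degree above \<open>n\<close>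
  and is controlled by Rankin's trick (\<open>truncated_product_close_to_model\<close>). So the mean is close to the
  product of the numbers \<open>1 + (z - 1) * u l\<close>, where \<open>u l = 1 / q ^ degree l - 1 / q ^ (2 * degree l)\<close>,
  hence to \<open>exp ((z - 1) * (\<Sum>l. u l))\<close> (\<open>model_product_close_to_exp\<close>). By the Mertens estimate for
  irreducible polynomials (\<open>mertens_irreducibles\<close>), a consequence of Gauss's formula for their number,
  \<open>(\<Sum>l. u l) = ln k + O(1)\<close>, which is \<open>ln n + O(ln (ln n))\<close>.

  Take \<open>z = iexp (t / sqrt (ln n))\<close>, so that \<open>norm (z - 1) = O(1 / sqrt (ln n))\<close>. All errors then tend to
  \<open>0\<close>, so the characteristic function of the normalised \<open>omega1\<close> has the same limit as that of a
  standardised Poisson variable of parameter \<open>ln n\<close>, namely \<open>exp (- t\<^sup>2 / 2)\<close>. Levy's continuity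
  theorem gives convergence in distribution.
\<close>

section \<open>Counting monic polynomials\<close>

lemma monic_polys_0: "monic_polys 0 = {1 :: 'a::{field,finite} poly}"
  by (auto simp: monic_polys_def elim!: degree_eq_zeroE)

lemma monic_polys_Suc:
  "monic_polys (Suc n) = (\<lambda>(c, g). pCons c g) ` (UNIV \<times> (monic_polys n :: 'a::{field,finite} poly set))"
proof (rule set_eqI)
  fix f :: "'a poly"
  show "f \<in> monic_polys (Suc n) \<longleftrightarrow> f \<in> (\<lambda>(c, g). pCons c g) ` (UNIV \<times> monic_polys n)"
    by (cases f) (auto simp: monic_polys_def image_iff split: if_splits)
qed

lemma finite_card_monic_polys:
  "finite (monic_polys n :: 'a::{field,finite} poly set) \<and>
   card (monic_polys n :: 'a poly set) = CARD('a) ^ n"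
proof (induction n)
  case (Suc n)
  have "inj_on (\<lambda>(c, g). pCons c g) (UNIV \<times> (monic_polys n :: 'a poly set))"
    by (auto simp: inj_on_def)
  with Suc show ?case
    by (simp add: monic_polys_Suc card_image card_cartesian_product)
qed (simp add: monic_polys_0)

lemmas finite_monic_polys [simp, intro] = finite_card_monic_polys[THEN conjunct1]
lemmas card_monic_polys = finite_card_monic_polys[THEN conjunct2]

lemma card_multiples_monic:
  fixes D :: "'a::{field,finite} poly"
  assumes "D \<in> monic_polys m"
  shows "card {f \<in> monic_polys n. D dvd f} = (if m \<le> n then CARD('a) ^ (n - m) else 0)"
proof -
  have D: "D \<noteq> 0" "lead_coeff D = 1" "degree D = m"
    using assms by (auto simp: monic_polys_def)
  show ?thesis
  proof (cases "m \<le> n")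
    case True
    have "{f \<in> monic_polys n. D dvd f} = (*) D ` monic_polys (n - m)"
    proof safe
      fix f assume f: "f \<in> monic_polys n" "D dvd f"
      then obtain g where g: "f = D * g" by blast
      with f D have "g \<noteq> 0" by (auto simp: monic_polys_def)
      with f D g have "g \<in> monic_polys (n - m)"
        by (auto simp: monic_polys_def degree_mult_eq coeff_mult_degree_sum)
      with g show "f \<in> (*) D ` monic_polys (n - m)" by blast
    next
      fix g :: "'a poly" assume g: "g \<in> monic_polys (n - m)"
      hence "g \<noteq> 0" by (auto simp: monic_polys_def)
      have "lead_coeff g = 1" "degree g = n - m" using g by (auto simp: monic_polys_def)
      have "lead_coeff (D * g) = 1"
        by (simp only: lead_coeff_mult D(2) \<open>lead_coeff g = 1\<close> mult_1)
      moreover have "degree (D * g) = n"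
        using \<open>g \<noteq> 0\<close> \<open>degree g = n - m\<close> D True by (simp add: degree_mult_eq)
      ultimately show "D * g \<in> monic_polys n" by (simp add: monic_polys_def)
    qed auto
    moreover have "inj_on ((*) D) (monic_polys (n - m))"
      using D by (auto simp: inj_on_def)
    ultimately show ?thesis using True by (simp add: card_image card_monic_polys)
  next
    case False
    have "\<not> D dvd f" if "f \<in> monic_polys n" for f
    proof -
      have "f \<noteq> 0" "degree f = n" using that by (auto simp: monic_polys_def)
      thus ?thesis using dvd_imp_degree_le[of D f] D False by auto
    qed
    hence "{f \<in> monic_polys n. D dvd f} = {}" by blast
    with False show ?thesis by (simp only: card.empty if_False)
  qed
qed

section \<open>Monic irreducible polynomials\<close>

text \<open>The monic irreducible polynomials of degree exactly \<open>d\<close>.\<close>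

definition monic_irreds :: "nat \<Rightarrow> 'a::{field,finite} poly set" where
  "monic_irreds d = {l. lead_coeff l = 1 \<and> irreducible l \<and> degree l = d}"

text \<open>The monic irreducible polynomials of degree at most \<open>k\<close>; irreducible polynomials have
  positive degree, so degree \<open>0\<close> is left out.\<close>

definition monic_irreds_upto :: "nat \<Rightarrow> 'a::{field,finite} poly set" where
  "monic_irreds_upto k = (\<Union>d\<in>{1..k}. monic_irreds d)"

lemma monic_irreds_subset: "monic_irreds d \<subseteq> monic_polys d"
  by (auto simp: monic_irreds_def monic_polys_def)

lemma finite_monic_irreds [simp, intro]: "finite (monic_irreds d)"
  by (rule finite_subset[OF monic_irreds_subset]) auto

lemma finite_monic_irreds_upto [simp, intro]: "finite (monic_irreds_upto k)"
  by (auto simp: monic_irreds_upto_def)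

lemma irreducible_degree_pos:
  fixes l :: "'a::field poly"
  assumes "irreducible l"
  shows "degree l > 0"
proof (rule ccontr)
  assume "\<not> degree l > 0"
  then obtain c where c: "l = [:c:]" by (auto elim: degree_eq_zeroE)
  with assms have "c \<noteq> 0" by (auto simp: irreducible_def)
  with c have "is_unit l" by (simp add: is_unit_poly_iff dvd_field_iff)
  with assms show False by (simp add: irreducible_def)
qed

lemma mem_monic_irreds_upto:
  "l \<in> monic_irreds_upto k \<longleftrightarrow> lead_coeff l = 1 \<and> irreducible l \<and> degree l \<le> k"
  using irreducible_degree_pos[of l]
  by (auto simp: monic_irreds_upto_def monic_irreds_def Suc_le_eq)

lemma sum_monic_irreds_upto:
  fixes F :: "'a::{field,finite} poly \<Rightarrow> 'b::comm_monoid_add"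
  shows "(\<Sum>l\<in>monic_irreds_upto k. F l) = (\<Sum>d=1..k. \<Sum>l\<in>monic_irreds d. F l)"
  unfolding monic_irreds_upto_def
  by (rule sum.UNION_disjoint) (auto, auto simp: monic_irreds_def)

lemma monic_irreducible_dvd_imp_eq:
  fixes l m :: "'a::field poly"
  assumes "irreducible l" "irreducible m" "lead_coeff l = 1" "lead_coeff m = 1" "l dvd m"
  shows "l = m"
proof -
  from \<open>l dvd m\<close> obtain r where r: "m = l * r" by blast
  with assms have "is_unit r" by (auto simp: irreducible_def)
  then obtain c where c: "r = [:c:]" by (auto simp: is_unit_poly_iff)
  have "lead_coeff m = lead_coeff l * c" unfolding r c by (simp add: lead_coeff_mult)
  with assms have "c = 1" by simp
  with r c show ?thesis by simp
qed

text \<open>Divisibility by powers of distinct monic irreducibles is a conjunction of independent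
  conditions. This is what makes the average over \<open>M_n\<close> of a product of local factors computable.\<close>

lemma prod_irreducible_powers_dvd_iff:
  fixes f :: "'a::field poly"
  assumes "finite S" "\<And>l. l \<in> S \<Longrightarrow> irreducible l \<and> lead_coeff l = 1"
  shows "(\<Prod>l\<in>S. l ^ e l) dvd f \<longleftrightarrow> (\<forall>l\<in>S. l ^ e l dvd f)"
  using assms
proof (induction S arbitrary: f rule: finite_induct)
  case (insert m S)
  show ?case
  proof
    assume *: "(\<Prod>l\<in>insert m S. l ^ e l) dvd f"
    show "\<forall>l\<in>insert m S. l ^ e l dvd f"
    proof
      fix l assume "l \<in> insert m S"
      with insert.hyps have "l ^ e l dvd (\<Prod>l\<in>insert m S. l ^ e l)"
        by (intro dvd_prodI) auto
      thus "l ^ e l dvd f" using * by (rule dvd_trans)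
    qed
  next
    assume *: "\<forall>l\<in>insert m S. l ^ e l dvd f"
    then obtain g where g: "f = m ^ e m * g" by (auto elim: dvdE)
    have "l ^ e l dvd g" if l: "l \<in> S" for l
    proof (cases "e l = 0")
      case False
      have pl: "prime_elem l" using insert.prems l by (auto intro: field_poly_irreducible_imp_prime)
      have "\<not> l dvd m"
        using monic_irreducible_dvd_imp_eq[of l m] insert.prems insert.hyps l by auto
      hence "\<not> l dvd m ^ e m" using prime_elem_dvd_power[OF pl] by blast
      with prime_power_dvd_multD[OF pl, of "e l" "m ^ e m" g] * g l False show ?thesis by auto
    qed simp
    hence "(\<Prod>l\<in>S. l ^ e l) dvd g" using insert.IH insert.prems by auto
    with g insert.hyps show "(\<Prod>l\<in>insert m S. l ^ e l) dvd f"
      by (simp add: mult_dvd_mono)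
  qed
qed simp

lemma monic_irreducible_factor_exists:
  fixes f :: "'a::field poly"
  assumes "degree f > 0"
  obtains l where "irreducible l" "lead_coeff l = 1" "l dvd f"
proof -
  \<comment> \<open>A nonconstant divisor of least degree, made monic, is irreducible.\<close>
  from assms have "\<exists>l. degree l > 0 \<and> l dvd f" by (intro exI[of _ f]) auto
  then obtain l where l: "degree l > 0" "l dvd f"
    and least: "\<And>m. degree m > 0 \<Longrightarrow> m dvd f \<Longrightarrow> degree l \<le> degree m"
    using ex_has_least_nat[of "\<lambda>l. degree l > 0 \<and> l dvd f" _ degree] by blast
  have l0: "l \<noteq> 0" using l by auto
  define m where "m = smult (inverse (lead_coeff l)) l"
  have unit: "is_unit a" if "a \<noteq> 0" "degree a = 0" for a :: "'a poly"
    using that by (auto simp: is_unit_poly_iff dvd_field_iff elim!: degree_eq_zeroE)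
  have deg_m: "degree m = degree l" and m_dvd: "m dvd f"
    using l l0 by (auto simp: m_def intro: smult_dvd)
  have "irreducible m"
  proof (rule irreducibleI)
    show "m \<noteq> 0" "\<not> is_unit m"
      using l deg_m by (auto simp: is_unit_poly_iff)
  next
    fix a b assume ab: "m = a * b"
    have nz: "a \<noteq> 0" "b \<noteq> 0" using ab l deg_m by auto
    hence deg: "degree l = degree a + degree b"
      using ab deg_m by (simp add: degree_mult_eq)
    have dvd: "a dvd f" "b dvd f"
      using ab m_dvd by (auto intro: dvd_trans)
    show "is_unit a \<or> is_unit b"
      using least[of a] least[of b] dvd deg nz unit by (cases "degree a = 0"; cases "degree b = 0") auto
  qed
  moreover have "lead_coeff m = 1" using l0 by (simp add: m_def)
  ultimately show ?thesis using m_dvd by (rule that)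
qed

text \<open>Unique factorisation, in the only form needed: the cardinality below is the multiplicity of
  \<open>l\<close> in \<open>f\<close>.\<close>

lemma degree_eq_sum_multiplicities:
  fixes f :: "'a::{field,finite} poly"
  assumes "f \<noteq> 0" "degree f \<le> n"
  shows "(\<Sum>l\<in>monic_irreds_upto n. degree l * card {j. 0 < j \<and> l ^ j dvd f}) = degree f"
  using assms
proof (induction "degree f" arbitrary: f rule: less_induct)
  case less
  show ?case
  proof (cases "degree f = 0")
    case True
    have "\<not> l ^ j dvd f" if "irreducible l" "0 < j" for l j
    proof
      assume "l ^ j dvd f"
      moreover have "l dvd l ^ j" using that by simp
      ultimately have "degree l \<le> degree f"
        using less.prems by (meson dvd_imp_degree_le dvd_trans)
      with True irreducible_degree_pos[OF that(1)] show False by simp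
    qed
    hence none: "{j. 0 < j \<and> l ^ j dvd f} = {}" if "l \<in> monic_irreds_upto n" for l
      using that by (auto simp: mem_monic_irreds_upto)
    have "degree l * card {j. 0 < j \<and> l ^ j dvd f} = 0" if "l \<in> monic_irreds_upto n" for l
      unfolding none[OF that] by simp
    thus ?thesis unfolding True by (intro sum.neutral ballI)
  next
    case False
    then obtain m where m: "irreducible m" "lead_coeff m = 1" "m dvd f"
      using monic_irreducible_factor_exists[of f] by blast
    from m(3) obtain g where g: "f = m * g" by (rule dvdE)
    have nz: "m \<noteq> 0" "g \<noteq> 0" using g less.prems by auto
    have deg: "degree f = degree m + degree g" using g nz by (simp add: degree_mult_eq)
    have m_pos: "degree m > 0" by (rule irreducible_degree_pos[OF m(1)])
    have m_mem: "m \<in> monic_irreds_upto n"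
      using m deg less.prems by (auto simp: mem_monic_irreds_upto)
    have IH: "(\<Sum>l\<in>monic_irreds_upto n. degree l * card {j. 0 < j \<and> l ^ j dvd g}) = degree g"
      using less.hyps[of g] deg m_pos nz less.prems by auto
    have other: "{j. 0 < j \<and> l ^ j dvd f} = {j. 0 < j \<and> l ^ j dvd g}"
      if l: "l \<in> monic_irreds_upto n - {m}" for l
    proof -
      have pl: "prime_elem l" and l': "irreducible l" "lead_coeff l = 1"
        using l by (auto simp: mem_monic_irreds_upto intro: field_poly_irreducible_imp_prime)
      have "\<not> l dvd m"
        using monic_irreducible_dvd_imp_eq[OF l'(1) m(1) l'(2) m(2)] l by auto
      hence "l ^ j dvd g" if "0 < j" "l ^ j dvd f" for j
        using prime_power_dvd_multD[OF pl, of j m g] that g by blast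
      moreover have "l ^ j dvd f" if "l ^ j dvd g" for j
        using that g by simp
      ultimately show ?thesis by blast
    qed
    have "finite {j. 0 < j \<and> m ^ j dvd g}"
    proof (rule finite_subset)
      show "{j. 0 < j \<and> m ^ j dvd g} \<subseteq> {..degree g}"
      proof safe
        fix j assume "m ^ j dvd g"
        hence "j * degree m \<le> degree g"
          using nz dvd_imp_degree_le[of "m ^ j" g] by (simp add: degree_power_eq)
        thus "j \<le> degree g" using m_pos by (metis Suc_leI le_trans mult.right_neutral mult_le_mono2 One_nat_def)
      qed
    qed auto
    moreover have "{j. 0 < j \<and> m ^ j dvd f} = insert 1 (Suc ` {j. 0 < j \<and> m ^ j dvd g})"
    proof (rule set_eqI)
      fix j
      show "j \<in> {j. 0 < j \<and> m ^ j dvd f} \<longleftrightarrow> j \<in> insert 1 (Suc ` {j. 0 < j \<and> m ^ j dvd g})"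
        using nz by (cases j; cases "j = 1") (auto simp: g image_iff)
    qed
    moreover have "1 \<notin> Suc ` {j. 0 < j \<and> m ^ j dvd g}" by auto
    ultimately have "card {j. 0 < j \<and> m ^ j dvd f} = Suc (card {j. 0 < j \<and> m ^ j dvd g})"
      by (simp add: card_image card_insert_disjoint)
    thus ?thesis
      using IH other m_mem deg by (simp add: sum.remove[of _ m] algebra_simps)
  qed
qed

section \<open>Averages over monic polynomials\<close>

text \<open>The mean value of \<open>F\<close> over the \<open>q\<^sup>n\<close> monic polynomials of degree \<open>n\<close>.\<close>

definition monic_avg :: "nat \<Rightarrow> ('a::{field,finite} poly \<Rightarrow> 'b::real_vector) \<Rightarrow> 'b" where
  "monic_avg n F = (\<Sum>f\<in>monic_polys n. F f) /\<^sub>R real CARD('a) ^ n"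

lemma monic_avg_cong:
  "(\<And>f. f \<in> monic_polys n \<Longrightarrow> F f = G f) \<Longrightarrow> monic_avg n F = monic_avg n G"
  by (simp add: monic_avg_def cong: sum.cong)

lemma monic_avg_const:
  "monic_avg n (\<lambda>f :: 'a::{field,finite} poly. c) = c"
  by (simp add: monic_avg_def card_monic_polys scaleR_conv_of_real sum_constant_scaleR)

lemma monic_avg_diff: "monic_avg n (\<lambda>f. F f - G f) = monic_avg n F - monic_avg n G"
  by (simp add: monic_avg_def sum_subtractf scaleR_diff_right)

lemma monic_avg_sum: "monic_avg n (\<lambda>f. \<Sum>i\<in>I. F i f) = (\<Sum>i\<in>I. monic_avg n (F i))"
  unfolding monic_avg_def scaleR_sum_right by (rule sum.swap)

lemma monic_avg_mult_left:
  fixes c :: "'b::real_algebra"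
  shows "monic_avg n (\<lambda>f. c * F f) = c * monic_avg n F"
  by (simp add: monic_avg_def sum_distrib_left)

lemma norm_monic_avg_le:
  fixes F :: "'a::{field,finite} poly \<Rightarrow> 'b::real_normed_vector"
  assumes "\<And>f. f \<in> monic_polys n \<Longrightarrow> norm (F f) \<le> G f"
  shows "norm (monic_avg n F) \<le> monic_avg n G"
proof -
  have "norm (\<Sum>f\<in>monic_polys n. F f) \<le> (\<Sum>f\<in>monic_polys n. G f)"
    using assms by (rule sum_norm_le)
  thus ?thesis by (simp add: monic_avg_def mult_left_mono divide_right_mono inverse_eq_divide)
qed

text \<open>A fixed monic \<open>D\<close> of degree at most \<open>n\<close> divides a random \<open>f\<close> in \<open>M_n\<close> with probability
  exactly \<open>1 / q ^ degree D\<close>; if its degree exceeds \<open>n\<close>, it never does.\<close>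

lemma monic_avg_dvd:
  fixes D :: "'a::{field,finite} poly"
  assumes "D \<in> monic_polys m"
  shows "monic_avg n (\<lambda>f. of_bool (D dvd f)) =
           (if m \<le> n then of_real (1 / real CARD('a) ^ m) else 0 :: 'b::real_normed_field)"
proof -
  have "{f. f \<in> monic_polys n \<and> D dvd f} = monic_polys n \<inter> {f. D dvd f}" by auto
  hence "monic_avg n (\<lambda>f. of_bool (D dvd f)) =
      (of_real (real (card {f \<in> monic_polys n. D dvd f}) / real CARD('a) ^ n) :: 'b)"
    by (simp add: monic_avg_def scaleR_conv_of_real divide_inverse mult.commute)
  also have "real (card {f \<in> monic_polys n. D dvd f}) / real CARD('a) ^ n =
      (if m \<le> n then 1 / real CARD('a) ^ m else 0)"
    using power_diff[of "real CARD('a)" m n] unfolding card_multiples_monic[OF assms] by simp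
  finally show ?thesis by simp
qed

section \<open>The density of irreducible polynomials\<close>

text \<open>Average \<open>degree f = (\<Sum>l. degree l * multiplicity of l in f)\<close> over \<open>M_n\<close>. The left side is \<open>n\<close>,
  and each pair \<open>(l, j)\<close> with \<open>j * degree l \<le> n\<close> contributes \<open>degree l / q ^ (j * degree l)\<close>.\<close>

lemma mean_degree_expansion:
  "real n = (\<Sum>(d, j)\<in>{(d, j). d \<in> {1..n} \<and> j \<in> {1..n} \<and> d * j \<le> n}.
     real d * real (card (monic_irreds d :: 'a::{field,finite} poly set)) / real CARD('a) ^ (d * j))"
proof -
  let ?q = "real CARD('a)"
  have mult: "real n = (\<Sum>l\<in>monic_irreds_upto n. real (degree l) * (\<Sum>j=1..n. of_bool (l ^ j dvd f)))"
    if f: "f \<in> monic_polys n" for f :: "'a poly"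
  proof -
    have f0: "f \<noteq> 0" "degree f = n" using f by (auto simp: monic_polys_def)
    have *: "{j. 0 < j \<and> l ^ j dvd f} = {1..n} \<inter> {j. l ^ j dvd f}" if "irreducible l" for l
    proof -
      have "j \<le> n" if j: "l ^ j dvd f" for j
      proof -
        have "j \<le> j * degree l" using irreducible_degree_pos[OF \<open>irreducible l\<close>] by simp
        also have "j * degree l = degree (l ^ j)"
          using \<open>irreducible l\<close> by (subst degree_power_eq) auto
        also have "\<dots> \<le> n" using dvd_imp_degree_le[OF j] f0 by simp
        finally show "j \<le> n" .
      qed
      thus ?thesis by auto
    qed
    have "n = (\<Sum>l\<in>monic_irreds_upto n. degree l * card {j. 0 < j \<and> l ^ j dvd f})"
      using degree_eq_sum_multiplicities[of f n] f0 by simp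
    also have "\<dots> = (\<Sum>l\<in>monic_irreds_upto n. degree l * card ({1..n} \<inter> {j. l ^ j dvd f}))"
      by (intro sum.cong refl) (simp only: * mem_monic_irreds_upto)
    finally show ?thesis
      by (subst (asm) of_nat_eq_iff[where ?'a = real, symmetric]) simp
  qed
  have pow: "l ^ j \<in> monic_polys (d * j)" if "l \<in> monic_irreds d" for l :: "'a poly" and d j
  proof -
    have l: "lead_coeff l = 1" "degree l = d" "l \<noteq> 0" using that by (auto simp: monic_irreds_def)
    have "lead_coeff (l ^ j) = 1" unfolding lead_coeff_power l(1) by simp
    moreover have "degree (l ^ j) = d * j" using l by (simp add: degree_power_eq)
    ultimately show ?thesis by (simp add: monic_polys_def)
  qed
  have "real n = monic_avg n (\<lambda>f :: 'a poly. real n)"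
    by (simp add: monic_avg_const)
  also have "\<dots> = monic_avg n (\<lambda>f :: 'a poly.
      \<Sum>l\<in>monic_irreds_upto n. real (degree l) * (\<Sum>j=1..n. of_bool (l ^ j dvd f)))"
    by (rule monic_avg_cong) (rule mult)
  also have "\<dots> = (\<Sum>l\<in>monic_irreds_upto n. real (degree l) *
      (\<Sum>j=1..n. monic_avg n (\<lambda>f :: 'a poly. of_bool (l ^ j dvd f))))"
    by (simp only: monic_avg_sum monic_avg_mult_left)
  also have "\<dots> = (\<Sum>d=1..n. \<Sum>l\<in>(monic_irreds d :: 'a poly set). real d *
      (\<Sum>j=1..n. if d * j \<le> n then 1 / ?q ^ (d * j) else 0))"
    unfolding sum_monic_irreds_upto
  proof (intro sum.cong refl arg_cong2[where f = "(*)"])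
    fix d j :: nat and l :: "'a poly" assume l: "l \<in> monic_irreds d"
    show "real (degree l) = real d" using l by (simp add: monic_irreds_def)
    show "monic_avg n (\<lambda>f. of_bool (l ^ j dvd f)) = (if d * j \<le> n then 1 / ?q ^ (d * j) else 0)"
      by (subst monic_avg_dvd[OF pow[OF l]]) simp
  qed
  also have "\<dots> = (\<Sum>d=1..n. \<Sum>j=1..n. if d * j \<le> n then
      real d * real (card (monic_irreds d :: 'a poly set)) / ?q ^ (d * j) else 0)"
    by (intro sum.cong refl) (auto simp: sum_distrib_left intro!: sum.cong)
  also have "\<dots> = (\<Sum>(d, j)\<in>{1..n} \<times> {1..n}. if d * j \<le> n then
      real d * real (card (monic_irreds d :: 'a poly set)) / ?q ^ (d * j) else 0)"
    by (simp add: sum.cartesian_product)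
  also have "\<dots> = (\<Sum>(d, j)\<in>{(d, j). d \<in> {1..n} \<and> j \<in> {1..n} \<and> d * j \<le> n}.
     real d * real (card (monic_irreds d :: 'a::{field,finite} poly set)) / ?q ^ (d * j))"
    by (rule sum.mono_neutral_cong_right) (auto split: if_splits)
  finally show ?thesis .
qed

text \<open>Gauss's formula \<open>(\<Sum>d | d dvd m. d * \<pi> d) = q ^ m\<close>, where \<open>\<pi> d\<close> counts the monic irreducibles of
  degree \<open>d\<close>: it is the difference of the previous expansion for \<open>m\<close> and for \<open>m - 1\<close>. The divisors
  are indexed by the factorisations \<open>m = d * j\<close>.\<close>

lemma gauss_irreducible_count:
  assumes "m > 0"
  shows "(\<Sum>(d, j)\<in>{(d, j). d * j = m}. real d * real (card (monic_irreds d :: 'a::{field,finite} poly set)))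
           = real CARD('a) ^ m"
proof -
  let ?q = "real CARD('a)"
  define T where "T n = {(d, j). d \<in> {1..n} \<and> j \<in> {1..n} \<and> d * j \<le> n}" for n :: nat
  define g where "g = (\<lambda>(d, j). real d * real (card (monic_irreds d :: 'a poly set)) / ?q ^ (d * j))"
  have T: "real n = sum g (T n)" for n
    using mean_degree_expansion[of n, where ?'a = 'a] by (simp add: T_def g_def)
  have fin: "finite (T n)" for n
    by (rule finite_subset[of _ "{1..n} \<times> {1..n}"]) (auto simp: T_def)
  obtain n where m: "m = Suc n" using assms by (cases m) auto
  have bound: "d \<le> m \<and> j \<le> m \<and> d > 0 \<and> j > 0" if "d * j = m" for d j
    using that assms by (metis dvd_imp_le dvd_triv_left dvd_triv_right nat_0_less_mult_iff)
  have "T m = T n \<union> {(d, j). d * j = m}"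
  proof (intro set_eqI)
    fix x :: "nat \<times> nat"
    obtain d j where x: "x = (d, j)" by (cases x)
    have "d \<le> n \<and> j \<le> n" if "d > 0" "j > 0" "d * j \<le> n"
      using that by (metis le_trans dvd_imp_le dvd_triv_left dvd_triv_right nat_0_less_mult_iff)
    thus "x \<in> T m \<longleftrightarrow> x \<in> T n \<union> {(d, j). d * j = m}"
      using bound[of d j] by (auto simp: x T_def m Suc_le_eq le_Suc_eq)
  qed
  moreover have "T n \<inter> {(d, j). d * j = m} = {}" by (auto simp: T_def m)
  moreover have "finite {(d, j). d * j = m}"
    by (rule finite_subset[of _ "{1..m} \<times> {1..m}"]) (use bound in \<open>force simp: Suc_le_eq\<close>)+
  ultimately have "sum g (T m) = sum g (T n) + sum g {(d, j). d * j = m}"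
    using fin by (simp add: sum.union_disjoint)
  hence "sum g {(d, j). d * j = m} = 1"
    using T[of m] T[of n] by (simp add: m)
  also have "sum g {(d, j). d * j = m} = (\<Sum>(d, j)\<in>{(d, j). d * j = m}.
      real d * real (card (monic_irreds d :: 'a poly set))) / ?q ^ m"
    unfolding sum_divide_distrib by (intro sum.cong refl) (auto simp: g_def)
  finally show ?thesis by (simp add: field_simps)
qed

lemma card_field_ge_2: "CARD('a::{field,finite}) \<ge> 2"
proof -
  have "card {0, 1 :: 'a} \<le> CARD('a)" by (rule card_mono) auto
  thus ?thesis by simp
qed

text \<open>The proportion of irreducibles among the monic polynomials of degree \<open>d\<close>. The first argument
  only carries the field.\<close>

definition irred_density :: "'a::{field,finite} itself \<Rightarrow> nat \<Rightarrow> real" where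
  "irred_density _ d = real (card (monic_irreds d :: 'a poly set)) / real CARD('a) ^ d"

lemma finite_factorisations:
  fixes m :: nat
  assumes "m > 0"
  shows "finite {(d, j). d * j = m}"
proof (rule finite_subset)
  show "{(d, j). d * j = m} \<subseteq> {..m} \<times> {..m}" using assms by auto
qed auto

lemma mult_card_irreds_le:
  assumes "d > 0"
  shows "real d * real (card (monic_irreds d :: 'a::{field,finite} poly set)) \<le> real CARD('a) ^ d"
proof -
  have "(\<Sum>(e, j)\<in>{(d, 1::nat)}. real e * real (card (monic_irreds e :: 'a poly set)))
      \<le> (\<Sum>(e, j)\<in>{(e, j). e * j = d}. real e * real (card (monic_irreds e :: 'a poly set)))"
    by (rule sum_mono2) (use finite_factorisations[OF assms] in auto)
  thus ?thesis unfolding gauss_irreducible_count[OF assms] by simp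
qed

lemma irred_density_le:
  assumes "d > 0"
  shows "irred_density T d \<le> 1 / real d"
  using mult_card_irreds_le[OF assms, where ?'a = 'a] assms
  by (simp add: irred_density_def field_simps)

text \<open>In Gauss's formula the proper divisors of \<open>m\<close> are at most \<open>m div 2\<close>, so together they
  contribute at most \<open>m * q ^ (m div 2)\<close>. Hence \<open>irred_density T m\<close> falls below \<open>1 / m\<close> by at most
  a geometrically small amount.\<close>

lemma irred_density_ge:
  fixes T :: "'a::{field,finite} itself"
  assumes m: "m > 0"
  shows "1 / real m - irred_density T m \<le> (1 / sqrt 2) ^ m"
proof -
  let ?q = "real CARD('a)"
  let ?c = "\<lambda>d. real d * real (card (monic_irreds d :: 'a poly set))"
  have q: "?q \<ge> 2" using card_field_ge_2[where ?'a = 'a] by linarith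
  let ?A = "{(d, j). d * j = m}"
  have fin: "finite ?A" by (rule finite_factorisations[OF m])
  have "?q ^ m = (\<Sum>x\<in>?A. ?c (fst x))"
    by (subst gauss_irreducible_count[OF m, symmetric]) (simp add: case_prod_unfold)
  also have "\<dots> = ?c m + (\<Sum>x\<in>?A - {(m, 1)}. ?c (fst x))"
    using fin by (subst sum.remove[of _ "(m, 1)"]) auto
  also have "(\<Sum>x\<in>?A - {(m, 1)}. ?c (fst x)) = (\<Sum>d\<in>fst ` (?A - {(m, 1)}). ?c d)"
  proof (subst sum.reindex)
    show "inj_on fst (?A - {(m, 1)})"
      using m by (auto simp: inj_on_def)
  qed simp
  also have "\<dots> \<le> (\<Sum>d=1..m div 2. ?c d)"
  proof (rule sum_mono2)
    have "d \<in> {1..m div 2}" if "d * j = m" "j \<noteq> 1" for d j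
    proof -
      have "j \<ge> 2" "d \<ge> 1" using that m by (cases j; cases "j = 1"; force)+
      hence "d * 2 \<le> m" using that(1) mult_le_mono2[of 2 j d] by simp
      thus ?thesis using \<open>d \<ge> 1\<close> by auto
    qed
    thus "fst ` (?A - {(m, 1)}) \<subseteq> {1..m div 2}" by force
  qed auto
  also have "\<dots> \<le> (\<Sum>d=1..m div 2. ?q ^ (m div 2))"
  proof (rule sum_mono)
    fix d assume d: "d \<in> {1..m div 2}"
    have "?c d \<le> ?q ^ d" using d by (intro mult_card_irreds_le) auto
    also have "\<dots> \<le> ?q ^ (m div 2)" using d q by (intro power_increasing) auto
    finally show "?c d \<le> ?q ^ (m div 2)" .
  qed
  also have "\<dots> \<le> real m * ?q ^ (m div 2)"
    by (simp add: mult_right_mono)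
  finally have "?q ^ m - ?c m \<le> real m * ?q ^ (m div 2)" by simp
  hence "(?q ^ m - ?c m) / (real m * ?q ^ m) \<le> real m * ?q ^ (m div 2) / (real m * ?q ^ m)"
    using q by (intro divide_right_mono) auto
  also have "(?q ^ m - ?c m) / (real m * ?q ^ m) = 1 / real m - irred_density T m"
    using m q by (simp add: irred_density_def field_simps)
  also have "real m * ?q ^ (m div 2) / (real m * ?q ^ m) = 1 / ?q ^ (m - m div 2)"
    using m q by (simp add: power_diff)
  also have "\<dots> \<le> 1 / 2 ^ (m - m div 2)"
    using q by (intro divide_left_mono power_mono) auto
  also have "(2::real) ^ (m - m div 2) = sqrt 2 ^ (2 * (m - m div 2))"
    by (simp add: power_mult)
  also have "1 / \<dots> \<le> 1 / sqrt 2 ^ m"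
    by (intro divide_left_mono power_increasing) auto
  finally show ?thesis by (simp add: power_divide)
qed

lemma sum_inverse_le_ln:
  assumes "1 \<le> k" "k \<le> n"
  shows "(\<Sum>d=k+1..n. 1 / real d) \<le> ln (real n / real k)"
  using assms(2)
proof (induction n rule: dec_induct)
  case (step n)
  have "1 / real (Suc n) \<le> ln (real (Suc n) / real n)"
    using ln_le_minus_one[of "real n / real (Suc n)"] step assms by (simp add: ln_div field_simps)
  also have "\<dots> = ln (real (Suc n) / real k) - ln (real n / real k)"
    using step assms by (simp add: ln_div)
  finally show ?case using step by simp
qed simp

lemma sum_inverse_approx_ln:
  assumes "1 \<le> k"
  shows "\<bar>(\<Sum>d=1..k. 1 / real d) - ln (real k)\<bar> \<le> 1"
proof -
  have "ln (real k) \<le> ln (real k + 1)" using assms by simp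
  also have "\<dots> \<le> (\<Sum>d=1..k. 1 / real d)"
    using ln_le_harm[of k] by (simp add: harm_def inverse_eq_divide)
  finally have "ln (real k) \<le> (\<Sum>d=1..k. 1 / real d)" .
  moreover have "(\<Sum>d=1..k. 1 / real d) = 1 + (\<Sum>d=1+1..k. 1 / real d)"
    using assms by (subst sum.atLeast_Suc_atMost) auto
  ultimately show ?thesis using sum_inverse_le_ln[of 1 k] assms by simp
qed

text \<open>The analogue of the theorem of Mertens on the sum of the reciprocals of the primes.\<close>

theorem mertens_irreducibles:
  fixes T :: "'a::{field,finite} itself"
  shows "\<exists>C\<ge>0. \<forall>k\<ge>1. \<bar>(\<Sum>d=1..k. irred_density T d) - ln (real k)\<bar> \<le> C"
proof -
  define C where "C = (\<Sum>m. (1 / sqrt 2) ^ m) + (1::real)"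
  have summ: "summable (\<lambda>m. (1 / sqrt 2) ^ m :: real)"
    by (rule summable_geometric) simp
  have "\<bar>(\<Sum>d=1..k. irred_density T d) - ln (real k)\<bar> \<le> C" if k: "k \<ge> 1" for k
  proof -
    have "\<bar>(\<Sum>d=1..k. irred_density T d) - (\<Sum>d=1..k. 1 / real d)\<bar> =
        \<bar>\<Sum>d=1..k. irred_density T d - 1 / real d\<bar>"
      by (simp add: sum_subtractf)
    also have "\<dots> \<le> (\<Sum>d=1..k. (1 / sqrt 2) ^ d)"
      using irred_density_le[of _ T] irred_density_ge[of _ T]
      by (intro order_trans[OF sum_abs] sum_mono) (force simp: abs_le_iff)
    also have "\<dots> \<le> (\<Sum>m. (1 / sqrt 2) ^ m)"
      by (intro sum_le_suminf summ) auto
    finally show ?thesis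
      using sum_inverse_approx_ln[OF k] unfolding C_def by linarith
  qed
  moreover have "C \<ge> 0"
    unfolding C_def by (intro add_nonneg_nonneg suminf_nonneg summ) auto
  ultimately show ?thesis by blast
qed

section \<open>Reduction to irreducible factors of small degree\<close>

text \<open>The local factor of \<open>z ^ omega1 f\<close> at \<open>l\<close>: it is \<open>z\<close> if \<open>l\<close> divides \<open>f\<close> exactly once, and \<open>1\<close>
  otherwise. It is written as a linear combination of divisibility indicators so that its averages
  follow from those of the indicators.\<close>

definition exact_factor :: "complex \<Rightarrow> 'a::{field,finite} poly \<Rightarrow> 'a poly \<Rightarrow> complex" where
  "exact_factor z l f = 1 + (z - 1) * (of_bool (l dvd f) - of_bool (l ^ 2 dvd f))"

lemma exact_factor_eq_if: "exact_factor z l f = (if l dvd f \<and> \<not> l ^ 2 dvd f then z else 1)"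
  using dvd_trans[of l "l ^ 2" f] by (auto simp: exact_factor_def)

lemma power_omega1:
  assumes "f \<in> monic_polys n"
  shows "z ^ omega1 f = (\<Prod>l\<in>monic_irreds_upto n. exact_factor z l f)"
proof -
  have f: "f \<noteq> 0" "degree f = n" using assms by (auto simp: monic_polys_def)
  have "{l. lead_coeff l = 1 \<and> irreducible l \<and> l dvd f \<and> \<not> l ^ 2 dvd f} =
      {l \<in> monic_irreds_upto n. l dvd f \<and> \<not> l ^ 2 dvd f}"
    using dvd_imp_degree_le[of _ f] f by (auto simp: mem_monic_irreds_upto)
  thus ?thesis
    by (simp add: omega1_def exact_factor_eq_if prod.If_cases Int_def)
qed

lemma irreducible_in_monic_polys:
  "l \<in> monic_irreds_upto k \<Longrightarrow> l \<in> monic_polys (degree l)"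
  by (simp add: mem_monic_irreds_upto monic_polys_def)

lemma sum_monic_irreds_upto_degree:
  "(\<Sum>l\<in>(monic_irreds_upto k :: 'a::{field,finite} poly set). h (degree l) / real CARD('a) ^ degree l) =
     (\<Sum>d=1..k. irred_density TYPE('a) d * h d)"
proof -
  have "(\<Sum>l\<in>(monic_irreds_upto k :: 'a poly set). h (degree l) / real CARD('a) ^ degree l) =
      (\<Sum>d=1..k. \<Sum>l\<in>(monic_irreds d :: 'a poly set). h d / real CARD('a) ^ d)"
    unfolding sum_monic_irreds_upto by (intro sum.cong refl) (simp add: monic_irreds_def)
  thus ?thesis by (simp add: irred_density_def)
qed

text \<open>Dropping the local factors of degree above \<open>k\<close> changes \<open>z ^ omega1 f\<close> by at most \<open>norm (z - 1)\<close>
  times the number of irreducible divisors of \<open>f\<close> of degree in \<open>{k<..n}\<close>, and the mean of that number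
  is at most \<open>ln (n / k)\<close>.\<close>

lemma large_irreducibles_negligible:
  fixes z :: complex
  assumes z: "norm z = 1" and k: "1 \<le> k" "k \<le> n"
  shows "norm (monic_avg n (\<lambda>f :: 'a::{field,finite} poly. z ^ omega1 f) -
               monic_avg n (\<lambda>f :: 'a poly. \<Prod>l\<in>monic_irreds_upto k. exact_factor z l f))
           \<le> norm (z - 1) * ln (real n / real k)"
proof -
  let ?I = "monic_irreds_upto n :: 'a poly set"
  have sub: "(\<Prod>l\<in>monic_irreds_upto k. exact_factor z l f) =
      (\<Prod>l\<in>?I. if degree l \<le> k then exact_factor z l f else 1)" for f :: "'a poly"
    by (intro prod.mono_neutral_cong_left) (use k in \<open>auto simp: mem_monic_irreds_upto\<close>)
  have ptw: "norm (z ^ omega1 f - (\<Prod>l\<in>monic_irreds_upto k. exact_factor z l f)) \<le>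
      (\<Sum>l\<in>?I. (if degree l \<le> k then 0 else norm (z - 1)) * of_bool (l dvd f))"
    if f: "f \<in> monic_polys n" for f :: "'a poly"
  proof -
    have "norm ((\<Prod>l\<in>?I. exact_factor z l f) -
        (\<Prod>l\<in>?I. if degree l \<le> k then exact_factor z l f else 1)) \<le>
      (\<Sum>l\<in>?I. norm (exact_factor z l f - (if degree l \<le> k then exact_factor z l f else 1)))"
      using z by (intro norm_prod_diff) (auto simp: exact_factor_eq_if)
    also have "\<dots> \<le> (\<Sum>l\<in>?I. (if degree l \<le> k then 0 else norm (z - 1)) * of_bool (l dvd f))"
      by (intro sum_mono) (auto simp: exact_factor_eq_if)
    finally show ?thesis using power_omega1[OF f] sub by simp
  qed
  have "norm (monic_avg n (\<lambda>f :: 'a poly. z ^ omega1 f - (\<Prod>l\<in>monic_irreds_upto k. exact_factor z l f))) \<le>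
      monic_avg n (\<lambda>f :: 'a poly. \<Sum>l\<in>?I. (if degree l \<le> k then 0 else norm (z - 1)) * of_bool (l dvd f))"
    by (intro norm_monic_avg_le ptw)
  also have "\<dots> = (\<Sum>l\<in>?I. (if degree l \<le> k then 0 else norm (z - 1)) / real CARD('a) ^ degree l)"
    unfolding monic_avg_sum monic_avg_mult_left
  proof (rule sum.cong[OF refl])
    fix l :: "'a poly" assume l: "l \<in> ?I"
    have "degree l \<le> n" using l by (simp add: mem_monic_irreds_upto)
    thus "(if degree l \<le> k then 0 else norm (z - 1)) * monic_avg n (\<lambda>f. of_bool (l dvd f)) =
        (if degree l \<le> k then 0 else norm (z - 1)) / real CARD('a) ^ degree l"
      by (subst monic_avg_dvd[OF irreducible_in_monic_polys[OF l]]) simp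
  qed
  also have "\<dots> = (\<Sum>d=1..n. irred_density TYPE('a) d * (if d \<le> k then 0 else norm (z - 1)))"
    by (rule sum_monic_irreds_upto_degree)
  also have "\<dots> = (\<Sum>d=k+1..n. irred_density TYPE('a) d * norm (z - 1))"
    by (rule sum.mono_neutral_cong_right) auto
  also have "\<dots> \<le> (\<Sum>d=k+1..n. 1 / real d * norm (z - 1))"
    by (intro sum_mono mult_right_mono irred_density_le) auto
  also have "\<dots> = norm (z - 1) * (\<Sum>d=k+1..n. 1 / real d)"
    by (simp add: sum_distrib_left)
  also have "\<dots> \<le> norm (z - 1) * ln (real n / real k)"
    by (intro mult_left_mono sum_inverse_le_ln k) auto
  finally show ?thesis by (simp add: monic_avg_diff)
qed

section \<open>Comparison with independent local factors\<close>

lemma prod_divide_power_eq: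
  fixes g :: "'b \<Rightarrow> 'c::field"
  shows "(\<Prod>l\<in>S. g l / q ^ (N l)) = (\<Prod>l\<in>S. g l) / q ^ (\<Sum>l\<in>S. N l)"
  by (simp add: prod_dividef power_sum)

text \<open>If the conditions at different irreducibles were independent, the mean of the product of the
  local factors would be the product of their means \<open>1 + (z - 1) * u l\<close>. Expanding both sides over
  the exponent patterns \<open>e\<close>, the terms agree except when the divisor \<open>(\<Prod>l\<in>S. l ^ e l)\<close> has degree
  above \<open>n\<close>. Those terms are bounded by Rankin's trick: insert the factor
  \<open>exp ((N e - n) / k)\<close>, at least \<open>1\<close> for these terms, sum over all \<open>e\<close>, and refold the sum into a product.
  The exponent \<open>1 / k\<close> keeps the factor at each \<open>l\<close> at most \<open>exp 1\<close> per unit of multiplicity.\<close>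

lemma truncated_product_close_to_model:
  fixes z :: complex
  assumes k: "1 \<le> k"
  defines "S \<equiv> monic_irreds_upto k :: 'a::{field,finite} poly set"
  defines "u \<equiv> \<lambda>l :: 'a poly. 1 / real CARD('a) ^ degree l - 1 / real CARD('a) ^ (2 * degree l)"
  shows "norm (monic_avg n (\<lambda>f. \<Prod>l\<in>S. exact_factor z l f) - (\<Prod>l\<in>S. 1 + (z - 1) * of_real (u l)))
           \<le> exp (- (real n / real k) + 12 * norm (z - 1) * (\<Sum>l\<in>S. 1 / real CARD('a) ^ degree l))"
proof -
  let ?q = "real CARD('a)"
  have q: "?q \<ge> 2" using card_field_ge_2[where ?'a = 'a] by linarith
  define w where "w = z - 1"
  define c where "c e = (if e = 0 then 1 else if e = 1 then w else - w)" for e :: nat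
  define E where "E = PiE S (\<lambda>_. {0, 1, 2 :: nat})"
  define N where "N e = (\<Sum>l\<in>S. e l * degree l)" for e :: "'a poly \<Rightarrow> nat"
  have finS: "finite S" by (simp add: S_def)
  have Sirr: "irreducible l \<and> lead_coeff l = 1" "degree l \<le> k" if "l \<in> S" for l
    using that by (auto simp: S_def mem_monic_irreds_upto)
  have expand: "(\<Prod>l\<in>S. exact_factor z l f) =
      (\<Sum>e\<in>E. (\<Prod>l\<in>S. c (e l)) * of_bool ((\<Prod>l\<in>S. l ^ e l) dvd f))" for f
  proof -
    have "(\<Prod>l\<in>S. exact_factor z l f) = (\<Prod>l\<in>S. \<Sum>e\<in>{0, 1, 2}. c e * of_bool (l ^ e dvd f))"
      by (intro prod.cong refl) (simp add: exact_factor_def c_def w_def algebra_simps)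
    also have "\<dots> = (\<Sum>e\<in>E. \<Prod>l\<in>S. c (e l) * of_bool (l ^ e l dvd f))"
      unfolding E_def by (rule prod_sum_PiE) (use finS in auto)
    also have "\<dots> = (\<Sum>e\<in>E. (\<Prod>l\<in>S. c (e l)) * of_bool ((\<Prod>l\<in>S. l ^ e l) dvd f))"
    proof (intro sum.cong refl)
      fix e
      have "(\<Prod>l\<in>S. of_bool (l ^ e l dvd f)) = (of_bool (\<forall>l\<in>S. l ^ e l dvd f) :: complex)"
        using finS by (induction S rule: finite_induct) auto
      thus "(\<Prod>l\<in>S. c (e l) * of_bool (l ^ e l dvd f)) =
          (\<Prod>l\<in>S. c (e l)) * of_bool ((\<Prod>l\<in>S. l ^ e l) dvd f)"
        using prod_irreducible_powers_dvd_iff[OF finS Sirr(1), where e = e and f = f]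
        by (simp add: prod.distrib)
    qed
    finally show ?thesis .
  qed
  have mem: "(\<Prod>l\<in>S. l ^ e l) \<in> monic_polys (N e)" for e
  proof -
    have "lead_coeff (\<Prod>l\<in>S. l ^ e l) = 1"
      using Sirr by (simp add: lead_coeff_prod lead_coeff_power)
    moreover have "degree (\<Prod>l\<in>S. l ^ e l) = N e"
    proof -
      have nz: "l \<noteq> 0" if "l \<in> S" for l using Sirr(1)[OF that] by auto
      hence "degree (\<Prod>l\<in>S. l ^ e l) = (\<Sum>l\<in>S. degree (l ^ e l))"
        by (intro degree_prod_eq_sum_degree) auto
      also have "\<dots> = N e" unfolding N_def
        using nz by (intro sum.cong) (auto simp: degree_power_eq)
      finally show ?thesis .
    qed
    ultimately show ?thesis by (simp add: monic_polys_def)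
  qed
  have A: "monic_avg n (\<lambda>f. \<Prod>l\<in>S. exact_factor z l f) =
      (\<Sum>e\<in>E. (\<Prod>l\<in>S. c (e l)) * (if N e \<le> n then of_real (1 / ?q ^ N e) else 0))"
    unfolding expand monic_avg_sum monic_avg_mult_left
    by (intro sum.cong refl arg_cong2[where f = "(*)"] monic_avg_dvd mem)
  have B: "(\<Prod>l\<in>S. 1 + (z - 1) * of_real (u l)) = (\<Sum>e\<in>E. (\<Prod>l\<in>S. c (e l)) * of_real (1 / ?q ^ N e))"
  proof -
    have "(\<Prod>l\<in>S. 1 + (z - 1) * of_real (u l)) =
        (\<Prod>l\<in>S. \<Sum>e\<in>{0, 1, 2}. c e / of_real ?q ^ (e * degree l))"
      by (intro prod.cong refl) (simp add: c_def w_def u_def algebra_simps diff_divide_distrib)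
    also have "\<dots> = (\<Sum>e\<in>E. \<Prod>l\<in>S. c (e l) / of_real ?q ^ (e l * degree l))"
      unfolding E_def by (rule prod_sum_PiE) (use finS in auto)
    finally show ?thesis by (simp add: prod_divide_power_eq N_def)
  qed
  have "norm (monic_avg n (\<lambda>f. \<Prod>l\<in>S. exact_factor z l f) - (\<Prod>l\<in>S. 1 + (z - 1) * of_real (u l))) =
      norm (\<Sum>e\<in>E. (\<Prod>l\<in>S. c (e l)) * (if N e \<le> n then 0 else of_real (1 / ?q ^ N e)))"
    unfolding A B sum_subtractf[symmetric]
    by (subst norm_minus_cancel[symmetric], subst sum_negf[symmetric])
       (intro arg_cong[where f = norm] sum.cong refl, simp)
  \<comment> \<open>The terms that remain have \<open>N e > n\<close>, so the exponential factor inserted here is at least \<open>1\<close>.\<close>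
  also have "\<dots> \<le> (\<Sum>e\<in>E. (\<Prod>l\<in>S. norm (c (e l))) * (exp ((real (N e) - real n) / real k) / ?q ^ N e))"
  proof (intro sum_norm_le)
    fix e
    have "norm (if N e \<le> n then 0 else of_real (1 / ?q ^ N e) :: complex) \<le>
        exp ((real (N e) - real n) / real k) / ?q ^ N e"
      using k by (auto simp: norm_divide norm_power intro!: divide_right_mono)
    thus "norm ((\<Prod>l\<in>S. c (e l)) * (if N e \<le> n then 0 else of_real (1 / ?q ^ N e))) \<le>
        (\<Prod>l\<in>S. norm (c (e l))) * (exp ((real (N e) - real n) / real k) / ?q ^ N e)"
      unfolding norm_mult prod_norm[symmetric] by (intro mult_left_mono) (auto intro: prod_nonneg)
  qed
  also have "\<dots> = exp (- (real n / real k)) *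
      (\<Sum>e\<in>E. \<Prod>l\<in>S. norm (c (e l)) * (exp (real (degree l) / real k) / ?q ^ degree l) ^ e l)"
    unfolding sum_distrib_left
  proof (intro sum.cong refl)
    fix e
    have "(\<Prod>l\<in>S. norm (c (e l)) * (exp (real (degree l) / real k) / ?q ^ degree l) ^ e l) =
        (\<Prod>l\<in>S. norm (c (e l)) * exp (real (e l * degree l) / real k) / ?q ^ (e l * degree l))"
      by (intro prod.cong refl)
         (simp add: power_divide exp_of_nat_mult[symmetric] power_mult[symmetric] mult.commute)
    also have "\<dots> = (\<Prod>l\<in>S. norm (c (e l))) * exp (real (N e) / real k) / ?q ^ N e"
      by (simp only: prod_divide_power_eq prod.distrib N_def exp_sum[OF finS, symmetric]
            sum_divide_distrib[symmetric] of_nat_sum)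
    finally show "(\<Prod>l\<in>S. norm (c (e l))) * (exp ((real (N e) - real n) / real k) / ?q ^ N e) =
        exp (- (real n / real k)) *
        (\<Prod>l\<in>S. norm (c (e l)) * (exp (real (degree l) / real k) / ?q ^ degree l) ^ e l)"
      by (simp add: exp_diff diff_divide_distrib exp_minus field_simps)
  qed
  also have "(\<Sum>e\<in>E. \<Prod>l\<in>S. norm (c (e l)) * (exp (real (degree l) / real k) / ?q ^ degree l) ^ e l) =
      (\<Prod>l\<in>S. \<Sum>e\<in>{0, 1, 2}. norm (c e) * (exp (real (degree l) / real k) / ?q ^ degree l) ^ e)"
    unfolding E_def by (rule prod_sum_PiE[symmetric]) (use finS in auto)
  also have "\<dots> \<le> (\<Prod>l\<in>S. exp (12 * norm w * (1 / ?q ^ degree l)))"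
  proof (intro prod_mono conjI)
    fix l assume l: "l \<in> S"
    define x where "x = exp (real (degree l) / real k) / ?q ^ degree l"
    define y where "y = 1 / ?q ^ degree l"
    have y: "0 \<le> y" "y \<le> 1" using q by (auto simp: y_def)
    have "exp (real (degree l) / real k) \<le> exp 1" using Sirr(2)[OF l] k by simp
    also have "\<dots> \<le> 3" by (rule exp_le)
    finally have x: "0 \<le> x" "x \<le> 3 * y"
      using q by (auto simp: x_def y_def divide_right_mono)
    have "x ^ 2 \<le> (3 * y) ^ 2" using x by (intro power_mono) auto
    also have "\<dots> = 9 * (y * y)" by (simp add: power2_eq_square)
    also have "\<dots> \<le> 9 * (y * 1)" using y by (intro mult_left_mono) auto
    finally have "x + x ^ 2 \<le> 12 * y" using x by simp
    hence "norm w * (x + x ^ 2) \<le> norm w * (12 * y)" by (intro mult_left_mono) auto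
    hence "1 + norm w * x + norm w * x ^ 2 \<le> 1 + 12 * norm w * y" by (simp add: algebra_simps)
    also have "\<dots> \<le> exp (12 * norm w * y)" by (rule exp_ge_add_one_self)
    finally show "(\<Sum>e\<in>{0, 1, 2}. norm (c e) * (exp (real (degree l) / real k) / ?q ^ degree l) ^ e) \<le>
        exp (12 * norm w * (1 / ?q ^ degree l))"
      unfolding x_def[symmetric] y_def[symmetric] by (simp add: c_def)
  qed (auto intro!: sum_nonneg)
  also have "\<dots> = exp (12 * norm w * (\<Sum>l\<in>S. 1 / ?q ^ degree l))"
    unfolding sum_distrib_left by (rule exp_sum[OF finS, symmetric])
  finally show ?thesis by (simp add: w_def mult_exp_exp)
qed

section \<open>The generating function of omega1\<close>

lemma sum_density_square_le:
  "(\<Sum>l\<in>(monic_irreds_upto k :: 'a::{field,finite} poly set). 1 / real CARD('a) ^ (2 * degree l)) \<le> 2"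
proof -
  let ?q = "real CARD('a)"
  have q: "?q \<ge> 2" using card_field_ge_2[where ?'a = 'a] by linarith
  have "(\<Sum>l\<in>(monic_irreds_upto k :: 'a poly set). 1 / ?q ^ (2 * degree l)) =
      (\<Sum>l\<in>(monic_irreds_upto k :: 'a poly set). (1 / ?q ^ degree l) / ?q ^ degree l)"
    by (simp add: mult_2 power_add)
  also have "\<dots> = (\<Sum>d=1..k. irred_density TYPE('a) d * (1 / ?q ^ d))"
    by (rule sum_monic_irreds_upto_degree)
  also have "\<dots> \<le> (\<Sum>d=1..k. 1 * (1 / 2) ^ d)"
  proof (intro sum_mono mult_mono)
    fix d assume d: "d \<in> {1..k}"
    have "irred_density TYPE('a) d \<le> 1 / real d" using d by (intro irred_density_le) auto
    also have "\<dots> \<le> 1" using d by simp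
    finally show "irred_density TYPE('a) d \<le> 1" .
    show "1 / ?q ^ d \<le> (1 / 2) ^ d"
      using q by (simp add: power_divide frac_le power_mono)
  qed auto
  also have "\<dots> \<le> (\<Sum>d. (1 / 2) ^ d)"
    by (simp, intro sum_le_suminf summable_geometric) auto
  also have "\<dots> = 2" by (simp add: suminf_geometric)
  finally show ?thesis .
qed

lemma norm_exp_diff_le:
  fixes x y :: complex
  assumes "Re y \<le> 0" "norm (x - y) \<le> V"
  shows "norm (exp x - exp y) \<le> exp V * V"
proof -
  have "exp x - exp y = exp y * (exp (x - y) - 1)" by (simp add: exp_diff algebra_simps)
  hence "norm (exp x - exp y) = exp (Re y) * norm (exp (x - y) - 1)" by (simp add: norm_mult)
  also have "\<dots> \<le> 1 * (exp (norm (x - y)) * norm (x - y))"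
    using assms Taylor_exp_field[of "x - y" 0] by (intro mult_mono) auto
  also have "\<dots> \<le> exp V * V"
    using assms(2) by (simp add: mult_mono)
  finally show ?thesis .
qed

text \<open>For \<open>norm z = 1\<close> and \<open>0 \<le> u l \<le> 1\<close> the factor \<open>1 + (z - 1) * u l\<close> is a convex combination of
  \<open>1\<close> and \<open>z\<close>, so all factors lie in the unit disc and the errors of replacing each one by an
  exponential just add up.\<close>

lemma model_product_close_to_exp:
  fixes z :: complex and u :: "'b \<Rightarrow> real"
  assumes z: "norm z = 1" and u: "\<And>l. l \<in> S \<Longrightarrow> 0 \<le> u l \<and> u l \<le> 1"
  shows "norm ((\<Prod>l\<in>S. 1 + (z - 1) * of_real (u l)) - exp ((z - 1) * of_real (\<Sum>l\<in>S. u l)))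
           \<le> 9 * norm (z - 1) ^ 2 * (\<Sum>l\<in>S. u l ^ 2)"
proof (cases "finite S")
  case True
  have Re: "Re (z - 1) \<le> 0" using complex_Re_le_cmod[of z] z by simp
  have "exp ((z - 1) * of_real (\<Sum>l\<in>S. u l)) = (\<Prod>l\<in>S. exp ((z - 1) * of_real (u l)))"
    using True by (simp add: sum_distrib_left exp_sum)
  moreover have "norm ((\<Prod>l\<in>S. 1 + (z - 1) * of_real (u l)) - (\<Prod>l\<in>S. exp ((z - 1) * of_real (u l))))
      \<le> (\<Sum>l\<in>S. norm (1 + (z - 1) * of_real (u l) - exp ((z - 1) * of_real (u l))))"
  proof (rule norm_prod_diff)
    fix l assume l: "l \<in> S"
    have "norm (1 + (z - 1) * of_real (u l)) = norm (of_real (1 - u l) + of_real (u l) * z)"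
      by (simp add: algebra_simps)
    also have "\<dots> \<le> norm (of_real (1 - u l) :: complex) + norm (of_real (u l) * z)"
      by (rule norm_triangle_ineq)
    also have "\<dots> = 1" using u[OF l] z by (simp add: norm_mult del: of_real_diff)
    finally show "norm (1 + (z - 1) * of_real (u l)) \<le> 1" .
    show "norm (exp ((z - 1) * of_real (u l))) \<le> 1"
      using Re u[OF l] by (simp add: mult_nonpos_nonneg)
  qed
  moreover have "norm (1 + (z - 1) * of_real (u l) - exp ((z - 1) * of_real (u l))) \<le>
      9 * norm (z - 1) ^ 2 * u l ^ 2" if l: "l \<in> S" for l
  proof -
    define x where "x = (z - 1) * of_real (u l)"
    have nx: "norm x = norm (z - 1) * u l" using u[OF l] by (simp add: x_def norm_mult)
    \<comment> \<open>The constant \<open>9\<close> bounds \<open>exp 2\<close>.\<close>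
    have "norm (z - 1) \<le> 2" using norm_triangle_ineq4[of z 1] z by simp
    hence "norm x \<le> 2 * 1" unfolding nx using u[OF l] by (intro mult_mono) auto
    hence "exp (norm x) \<le> exp 1 * exp 1" by (simp flip: exp_add)
    also have "\<dots> \<le> 3 * (3::real)" by (intro mult_mono exp_le) auto
    finally have ex: "exp (norm x) \<le> 9" by simp
    have "norm (1 + x - exp x) \<le> exp (norm x) * norm x ^ 2"
      using Taylor_exp_field[of x 1] by (simp add: norm_minus_commute power2_eq_square)
    also have "\<dots> \<le> 9 * norm x ^ 2" by (intro mult_right_mono ex) auto
    finally show ?thesis by (simp add: nx x_def[symmetric] power_mult_distrib)
  qed
  ultimately show ?thesis
    unfolding sum_distrib_left by (smt (verit, best) sum_mono)
qed simp

text \<open>On the unit circle, the mean of \<open>z ^ omega1 f\<close> over \<open>M_n\<close> is close to \<open>exp ((z - 1) * ln n)\<close>, the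
  value for a Poisson variable of parameter \<open>ln n\<close>. The four error terms come, in this order, from the
  irreducibles of degree above \<open>k\<close>, from the passage to independent factors, from exponentiating the
  product, and from replacing the sum of the \<open>u l\<close> by \<open>ln n\<close>.\<close>

theorem omega1_generating_function_estimate:
  "\<exists>C\<ge>0. \<forall>(z::complex) k n. norm z = 1 \<longrightarrow> 1 \<le> k \<longrightarrow> k \<le> n \<longrightarrow>
     norm (monic_avg n (\<lambda>f :: 'a::{field,finite} poly. z ^ omega1 f) - exp ((z - 1) * of_real (ln (real n))))
     \<le> norm (z - 1) * ln (real n / real k)
        + exp (- (real n / real k) + 12 * norm (z - 1) * (ln (real n) + C))
        + 18 * norm (z - 1) ^ 2
        + exp (norm (z - 1) * (ln (real n / real k) + C)) * (norm (z - 1) * (ln (real n / real k) + C))"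
proof -
  let ?q = "real CARD('a)"
  have q: "?q \<ge> 2" using card_field_ge_2[where ?'a = 'a] by linarith
  obtain C0 where C0: "C0 \<ge> 0"
    "\<And>k. k \<ge> 1 \<Longrightarrow> \<bar>(\<Sum>d=1..k. irred_density TYPE('a) d) - ln (real k)\<bar> \<le> C0"
    using mertens_irreducibles[of "TYPE('a)"] by blast
  \<comment> \<open>The extra \<open>2\<close> absorbs the sum of the terms \<open>1 / q ^ (2 * degree l)\<close>.\<close>
  define C where "C = C0 + 2"
  have "norm (monic_avg n (\<lambda>f :: 'a poly. z ^ omega1 f) - exp ((z - 1) * of_real (ln (real n))))
     \<le> norm (z - 1) * ln (real n / real k)
        + exp (- (real n / real k) + 12 * norm (z - 1) * (ln (real n) + C))
        + 18 * norm (z - 1) ^ 2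
        + exp (norm (z - 1) * (ln (real n / real k) + C)) * (norm (z - 1) * (ln (real n / real k) + C))"
    if z: "norm z = 1" and k: "1 \<le> k" "k \<le> n" for z :: complex and k n
  proof -
    define S where "S = (monic_irreds_upto k :: 'a poly set)"
    define u where "u = (\<lambda>l :: 'a poly. 1 / ?q ^ degree l - 1 / ?q ^ (2 * degree l))"
    define U where "U = (\<Sum>l\<in>S. u l)"
    define W where "W = norm (z - 1)"
    define L where "L = ln (real n / real k)"
    have L: "L = ln (real n) - ln (real k)" "L \<ge> 0"
      using k by (auto simp: L_def ln_div)
    have W: "W \<ge> 0" by (simp add: W_def)
    have sum1: "(\<Sum>l\<in>S. 1 / ?q ^ degree l) = (\<Sum>d=1..k. irred_density TYPE('a) d)"
      using sum_monic_irreds_upto_degree[of "\<lambda>_. 1" k, where ?'a = 'a] by (simp add: S_def)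
    have sum2: "(\<Sum>l\<in>S. 1 / ?q ^ (2 * degree l)) \<le> 2" "0 \<le> (\<Sum>l\<in>S. 1 / ?q ^ (2 * degree l))"
      using sum_density_square_le[of k, where ?'a = 'a] by (auto simp: S_def intro: sum_nonneg)
    have u: "0 \<le> u l \<and> u l \<le> 1 / ?q ^ degree l" for l
      using q by (auto simp: u_def intro!: divide_left_mono power_increasing)
    have u1: "0 \<le> u l \<and> u l \<le> 1" for l
      using u[of l] q by (auto intro: order_trans)
    have E1: "norm (monic_avg n (\<lambda>f :: 'a poly. z ^ omega1 f) -
        monic_avg n (\<lambda>f. \<Prod>l\<in>S. exact_factor z l f)) \<le> W * L"
      unfolding W_def L_def S_def by (rule large_irreducibles_negligible[OF z k])
    have "norm (monic_avg n (\<lambda>f. \<Prod>l\<in>S. exact_factor z l f) - (\<Prod>l\<in>S. 1 + (z - 1) * of_real (u l)))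
        \<le> exp (- (real n / real k) + 12 * W * (\<Sum>l\<in>S. 1 / ?q ^ degree l))"
      unfolding W_def S_def u_def by (rule truncated_product_close_to_model[OF k(1)])
    also have "\<dots> \<le> exp (- (real n / real k) + 12 * W * (ln (real n) + C))"
      using C0(2)[OF k(1)] L W unfolding sum1 C_def
      by (auto intro!: mult_left_mono simp: abs_le_iff)
    finally have E2: "norm (monic_avg n (\<lambda>f. \<Prod>l\<in>S. exact_factor z l f) -
        (\<Prod>l\<in>S. 1 + (z - 1) * of_real (u l))) \<le> exp (- (real n / real k) + 12 * W * (ln (real n) + C))" .
    have "(\<Sum>l\<in>S. u l ^ 2) \<le> (\<Sum>l\<in>S. 1 / ?q ^ (2 * degree l))"
    proof (intro sum_mono)
      fix l
      have "u l ^ 2 \<le> (1 / ?q ^ degree l) ^ 2" using u[of l] by (intro power_mono) auto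
      thus "u l ^ 2 \<le> 1 / ?q ^ (2 * degree l)" by (simp add: power_divide power_even_eq)
    qed
    with sum2 have "9 * W ^ 2 * (\<Sum>l\<in>S. u l ^ 2) \<le> 9 * W ^ 2 * 2"
      by (intro mult_left_mono) auto
    hence E3: "norm ((\<Prod>l\<in>S. 1 + (z - 1) * of_real (u l)) - exp ((z - 1) * of_real U)) \<le> 18 * W ^ 2"
      using model_product_close_to_exp[OF z, of S u] u1 unfolding U_def W_def by fastforce
    have "U = (\<Sum>d=1..k. irred_density TYPE('a) d) - (\<Sum>l\<in>S. 1 / ?q ^ (2 * degree l))"
      by (simp add: U_def u_def sum_subtractf sum1)
    hence UL: "\<bar>U - ln (real n)\<bar> \<le> L + C"
      using C0(2)[OF k(1)] sum2 L unfolding C_def by (simp add: abs_le_iff)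
    have "norm (exp ((z - 1) * of_real U) - exp ((z - 1) * of_real (ln (real n)))) \<le>
        exp (W * (L + C)) * (W * (L + C))"
    proof (rule norm_exp_diff_le)
      have "Re (z - 1) \<le> 0" using complex_Re_le_cmod[of z] z by simp
      thus "Re ((z - 1) * of_real (ln (real n))) \<le> 0"
        using k by (simp add: mult_nonpos_nonneg)
      have "norm ((z - 1) * of_real U - (z - 1) * of_real (ln (real n))) = W * \<bar>U - ln (real n)\<bar>"
        by (simp add: W_def norm_mult flip: right_diff_distrib of_real_diff)
      thus "norm ((z - 1) * of_real U - (z - 1) * of_real (ln (real n))) \<le> W * (L + C)"
        using UL W by (simp add: mult_left_mono)
    qed
    moreover have "norm (a - e) \<le> norm (a - b) + norm (b - c) + norm (c - d) + norm (d - e)"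
      for a b c d e :: complex
      by norm
    ultimately show ?thesis
      unfolding W_def[symmetric] L_def[symmetric]
      using E1 E2 E3 by (meson add_mono order_trans)
  qed
  moreover have "C \<ge> 0" using C0 by (simp add: C_def)
  ultimately show ?thesis by blast
qed

section \<open>Convergence of the characteristic functions\<close>

text \<open>The cutoff \<open>k = n / ln n\<close> balances the error terms: \<open>n / k\<close> outgrows \<open>sqrt (ln n)\<close>, while
  \<open>ln (n / k)\<close>, of order \<open>ln (ln n)\<close>, is negligible against it.\<close>

lemma cutoff_bounds:
  "eventually (\<lambda>n. let k = nat \<lfloor>real n / ln (real n)\<rfloor> in
     1 \<le> k \<and> k \<le> n \<and> ln (real n) \<le> real n / real k \<and> real n / real k \<le> 2 * ln (real n)) sequentially"
proof -
  have "eventually (\<lambda>n. 1 \<le> ln (real n)) sequentially" by real_asymp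
  thus ?thesis
  proof eventually_elim
    case (elim n)
    define k where "k = nat \<lfloor>real n / ln (real n)\<rfloor>"
    define x where "x = real n / ln (real n)"
    have n: "n > 0" using elim by (cases n) auto
    have "ln (real n) \<le> real n" using ln_le_minus_one[of "real n"] n by simp
    hence "1 \<le> x"
      using divide_right_mono[of "ln (real n)" "real n" "ln (real n)"] elim
      by (cases "n = Suc 0") (simp_all add: x_def)
    moreover have "x \<le> real n"
      using divide_left_mono[of 1 "ln (real n)" "real n"] elim by (simp add: x_def)
    ultimately have x: "1 \<le> x" "x \<le> real n" .
    have k: "real k \<le> x" "x < real k + 1" "1 \<le> k"
      using x by (auto simp: k_def x_def[symmetric]) linarith+
    have "x \<le> 2 * real k" using k by linarith
    hence "real n / real k \<le> 2 * ln (real n)"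
      using k elim by (simp add: x_def field_simps)
    moreover have "ln (real n) \<le> real n / real k"
      using k elim by (simp add: x_def field_simps)
    moreover have "k \<le> n" using k x by linarith
    ultimately show ?case using k by (simp add: k_def)
  qed
qed

lemma norm_iexp_minus_one_le: "norm (iexp x - 1) \<le> \<bar>x\<bar>"
  using iexp_approx1[of x 0] by simp

lemma omega1_characteristic_function_approx:
  fixes t :: real
  shows "(\<lambda>n. monic_avg n (\<lambda>f :: 'a::{field,finite} poly. iexp (t / sqrt (ln (real n))) ^ omega1 f)
            - exp ((iexp (t / sqrt (ln (real n))) - 1) * of_real (ln (real n)))) \<longlonglongrightarrow> 0"
proof -
  obtain C where C: "C \<ge> 0" "\<And>(z::complex) k n. norm z = 1 \<Longrightarrow> 1 \<le> k \<Longrightarrow> k \<le> n \<Longrightarrow>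
     norm (monic_avg n (\<lambda>f :: 'a poly. z ^ omega1 f) - exp ((z - 1) * of_real (ln (real n))))
     \<le> norm (z - 1) * ln (real n / real k)
        + exp (- (real n / real k) + 12 * norm (z - 1) * (ln (real n) + C))
        + 18 * norm (z - 1) ^ 2
        + exp (norm (z - 1) * (ln (real n / real k) + C)) * (norm (z - 1) * (ln (real n / real k) + C))"
    using omega1_generating_function_estimate[where ?'a = 'a] by metis
  define \<tau> where "\<tau> = \<bar>t\<bar>"
  define V where "V D n = \<tau> / sqrt (ln (real n)) * (ln (2 * ln (real n)) + D)" for D n
  define B where "B n = V 0 n + exp (- ln (real n) + 12 * (\<tau> / sqrt (ln (real n))) * (ln (real n) + C))
      + 18 * (\<tau> / sqrt (ln (real n))) ^ 2 + exp (V C n) * V C n" for n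
  have V0: "V D \<longlonglongrightarrow> 0" for D unfolding V_def by real_asymp
  have "(\<lambda>n. exp (- ln (real n) + 12 * (\<tau> / sqrt (ln (real n))) * (ln (real n) + C))) \<longlonglongrightarrow> 0"
  proof (cases "\<tau> = 0")
    case True
    thus ?thesis by simp real_asymp
  next
    case False
    hence "\<tau> > 0" by (simp add: \<tau>_def)
    thus ?thesis by real_asymp
  qed
  moreover have "(\<lambda>n. 18 * (\<tau> / sqrt (ln (real n))) ^ 2) \<longlonglongrightarrow> 18 * 0 ^ 2"
    by (intro tendsto_mult tendsto_power tendsto_const) real_asymp
  moreover have "(\<lambda>n. exp (V C n) * V C n) \<longlonglongrightarrow> exp 0 * 0"
    by (intro tendsto_mult tendsto_exp V0)
  ultimately have "(\<lambda>n. B n) \<longlonglongrightarrow> 0 + 0 + 18 * 0 ^ 2 + exp 0 * 0"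
    unfolding B_def using V0[of 0] by (intro tendsto_add) auto
  hence B0: "B \<longlonglongrightarrow> 0" by simp
  have "eventually (\<lambda>n. 1 \<le> ln (real n)) sequentially" by real_asymp
  with cutoff_bounds have "eventually (\<lambda>n. norm (monic_avg n
      (\<lambda>f :: 'a poly. iexp (t / sqrt (ln (real n))) ^ omega1 f)
            - exp ((iexp (t / sqrt (ln (real n))) - 1) * of_real (ln (real n)))) \<le> B n) sequentially"
  proof eventually_elim
    case (elim n)
    define k where "k = nat \<lfloor>real n / ln (real n)\<rfloor>"
    define z where "z = iexp (t / sqrt (ln (real n)))"
    define W where "W = norm (z - 1)"
    define R where "R = real n / real k"
    have k: "1 \<le> k" "k \<le> n" "ln (real n) \<le> R" "R \<le> 2 * ln (real n)"
      using elim(1) by (auto simp: k_def R_def Let_def)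
    have R: "R \<ge> 1" using k elim by linarith
    have W: "0 \<le> W" "W \<le> \<tau> / sqrt (ln (real n))"
      using norm_iexp_minus_one_le[of "t / sqrt (ln (real n))"] elim
      by (auto simp: W_def z_def \<tau>_def)
    have lnR: "0 \<le> ln R" "ln R \<le> ln (2 * ln (real n))" using R k(4) by simp_all
    have V: "W * (ln R + D) \<le> V D n" if "D \<ge> 0" for D
      unfolding V_def using W lnR that by (intro mult_mono) auto
    have z: "norm z = 1" by (simp add: z_def)
    note C(2)[OF z k(1,2), folded W_def R_def]
    also have "W * ln R + exp (- R + 12 * W * (ln (real n) + C)) + 18 * W ^ 2
        + exp (W * (ln R + C)) * (W * (ln R + C)) \<le> B n"
      unfolding B_def
    proof (intro add_mono)
      show "W * ln R \<le> V 0 n" using V[of 0] by simp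
      have "12 * W * (ln (real n) + C) \<le> 12 * (\<tau> / sqrt (ln (real n))) * (ln (real n) + C)"
        using W C(1) elim by (intro mult_right_mono mult_left_mono) auto
      thus "exp (- R + 12 * W * (ln (real n) + C)) \<le>
          exp (- ln (real n) + 12 * (\<tau> / sqrt (ln (real n))) * (ln (real n) + C))"
        using k by simp
      show "18 * W ^ 2 \<le> 18 * (\<tau> / sqrt (ln (real n))) ^ 2"
        using W by (intro mult_left_mono power_mono) auto
      show "exp (W * (ln R + C)) * (W * (ln R + C)) \<le> exp (V C n) * V C n"
        using V[OF C(1)] W lnR C(1) by (intro mult_mono) auto
    qed
    finally show ?case by (simp add: z_def)
  qed
  thus ?thesis by (rule Lim_null_comparison) (rule B0)
qed

text \<open>The characteristic function of the standardised Poisson variable of parameter \<open>ln n\<close>, by the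
  second-order Taylor expansion of \<open>iexp\<close>.\<close>

lemma centred_exponent_tendsto:
  fixes t :: real
  shows "(\<lambda>n. iexp (- t * sqrt (ln (real n))) *
            exp ((iexp (t / sqrt (ln (real n))) - 1) * of_real (ln (real n))))
         \<longlonglongrightarrow> of_real (exp (- t\<^sup>2 / 2))"
proof -
  define e where "e n = \<i> * of_real (- t * sqrt (ln (real n))) +
      (iexp (t / sqrt (ln (real n))) - 1) * of_real (ln (real n))" for n :: nat
  have "(\<lambda>n. e n - of_real (- t\<^sup>2 / 2)) \<longlonglongrightarrow> 0"
  proof (rule Lim_null_comparison)
    have "eventually (\<lambda>n. 1 \<le> ln (real n)) sequentially" by real_asymp
    thus "eventually (\<lambda>n. norm (e n - of_real (- t\<^sup>2 / 2)) \<le> \<bar>t\<bar> ^ 3 / (6 * sqrt (ln (real n)))) sequentially"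
    proof eventually_elim
      case (elim n)
      define \<sigma> where "\<sigma> = sqrt (ln (real n))"
      have \<sigma>: "\<sigma> > 0" "ln (real n) = \<sigma>\<^sup>2" using elim by (auto simp: \<sigma>_def)
      have "e n - of_real (- t\<^sup>2 / 2) =
          of_real (\<sigma>\<^sup>2) * (iexp (t / \<sigma>) - (\<Sum>k\<le>2. (\<i> * of_real (t / \<sigma>)) ^ k / fact k))"
        using \<sigma> unfolding e_def \<sigma>_def[symmetric]
        by (simp add: numeral_2_eq_2 field_simps power2_eq_square)
      hence "norm (e n - of_real (- t\<^sup>2 / 2)) =
          \<sigma>\<^sup>2 * norm (iexp (t / \<sigma>) - (\<Sum>k\<le>2. (\<i> * of_real (t / \<sigma>)) ^ k / fact k))"
        by (simp only: norm_mult norm_of_real abs_power2 power2_abs abs_of_nonneg zero_le_power2)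
      also have "\<dots> \<le> \<sigma>\<^sup>2 * (\<bar>t / \<sigma>\<bar> ^ Suc 2 / fact (Suc 2))"
        by (intro mult_left_mono iexp_approx1) auto
      also have "\<dots> = \<bar>t\<bar> ^ 3 / (6 * \<sigma>)"
        using \<sigma> by (simp add: fact_numeral power3_eq_cube power2_eq_square field_simps abs_divide numeral_2_eq_2)
      finally show ?case by (simp add: \<sigma>_def)
    qed
    show "(\<lambda>n. \<bar>t\<bar> ^ 3 / (6 * sqrt (ln (real n)))) \<longlonglongrightarrow> 0" by real_asymp
  qed
  hence "e \<longlonglongrightarrow> of_real (- t\<^sup>2 / 2)" by (rule LIM_zero_cancel)
  hence "(\<lambda>n. exp (e n)) \<longlonglongrightarrow> exp (of_real (- t\<^sup>2 / 2))" by (rule tendsto_exp)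
  thus ?thesis by (simp only: e_def exp_add exp_of_real)
qed

section \<open>The limit theorem\<close>

lemma cdf_std_normal_distribution: "cdf std_normal_distribution a = std_normal_cdf a"
proof -
  have int: "integrable lborel (\<lambda>x. indicator {..a} x * std_normal_density x)"
    using integrable_mult_indicator[of "{..a}" lborel std_normal_density] by simp
  have "emeasure std_normal_distribution {..a} =
      (\<integral>\<^sup>+x. ennreal (indicator {..a} x * std_normal_density x) \<partial>lborel)"
    by (subst emeasure_density) (auto intro!: nn_integral_cong split: split_indicator)
  also have "\<dots> = ennreal (\<integral>x. indicator {..a} x * std_normal_density x \<partial>lborel)"
    using int by (intro nn_integral_eq_integral) auto
  finally have "cdf std_normal_distribution a = (\<integral>x. indicator {..a} x * std_normal_density x \<partial>lborel)"
    by (simp add: cdf_def measure_def)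
  also have "\<dots> = (\<integral>x. 1 / sqrt (2 * pi) * (indicator {..a} x * exp (- (x\<^sup>2 / 2))) \<partial>lborel)"
    by (intro Bochner_Integration.integral_cong) (auto simp: std_normal_density_def)
  also have "\<dots> = std_normal_cdf a"
    by (simp add: std_normal_cdf_def set_lebesgue_integral_def)
  finally show ?thesis .
qed

lemma isCont_cdf_std_normal_distribution: "isCont (cdf std_normal_distribution) a"
proof -
  interpret real_distribution std_normal_distribution by (rule real_dist_normal_dist)
  have "emeasure std_normal_distribution {a} = 0"
    by (subst emeasure_density) auto
  thus ?thesis by (simp add: isCont_cdf measure_def)
qed

theorem theorem1p5:
  fixes a :: real
  shows "(\<lambda>n. 1 / real CARD('a::{field, finite}) ^ n *
            real (card {f :: 'a poly. f \<in> monic_polys n \<and>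
              (real (omega1 f) - ln (real n)) / sqrt (ln (real n)) \<le> a}))
          \<longlonglongrightarrow> std_normal_cdf a"
proof -
  define X where "X n f = (real (omega1 f) - ln (real n)) / sqrt (ln (real n))" for n and f :: "'a poly"
  define U where "U n = pmf_of_set (monic_polys n :: 'a poly set)" for n
  define M where "M n = distr (measure_pmf (U n)) borel (X n)" for n
  have ne: "(monic_polys n :: 'a poly set) \<noteq> {}" for n
    using card_monic_polys[of n, where ?'a = 'a] by auto
  have distr: "real_distribution (M n)" for n
    unfolding M_def by (intro prob_space.real_distribution_distr measure_pmf.prob_space_axioms) auto
  have char_eq: "char (M n) t = monic_avg n (\<lambda>f. iexp (t * X n f))" for n t
  proof -
    have "char (M n) t = (CLINT f|measure_pmf (U n). iexp (t * X n f))"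
      unfolding char_def M_def by (subst integral_distr) auto
    also have "\<dots> = (\<Sum>f\<in>monic_polys n. pmf (U n) f *\<^sub>R iexp (t * X n f))"
      by (rule integral_measure_pmf) (use ne in \<open>auto simp: U_def\<close>)
    also have "\<dots> = monic_avg n (\<lambda>f. iexp (t * X n f))"
      unfolding monic_avg_def scaleR_sum_right
      by (intro sum.cong refl) (use ne in \<open>simp add: U_def card_monic_polys divide_inverse\<close>)
    finally show ?thesis .
  qed
  have "(\<lambda>n. char (M n) t) \<longlonglongrightarrow> char std_normal_distribution t" for t
  proof -
    define \<sigma> where "\<sigma> n = sqrt (ln (real n))" for n :: nat
    define A where "A n = monic_avg n (\<lambda>f :: 'a poly. iexp (t / \<sigma> n) ^ omega1 f)" for n
    define G where "G n = exp ((iexp (t / \<sigma> n) - 1) * of_real (ln (real n)))" for n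
    have "(\<lambda>n. iexp (- t * \<sigma> n) * (A n - G n)) \<longlonglongrightarrow> 0"
    proof (rule tendsto_norm_zero_cancel)
      have "(\<lambda>n. norm (A n - G n)) \<longlonglongrightarrow> 0"
        using omega1_characteristic_function_approx[of t, where ?'a = 'a]
        unfolding A_def G_def \<sigma>_def by (rule tendsto_norm_zero)
      thus "(\<lambda>n. norm (iexp (- t * \<sigma> n) * (A n - G n))) \<longlonglongrightarrow> 0" 
        unfolding norm_mult norm_exp_i_times by simp
    qed
    moreover have "(\<lambda>n. iexp (- t * \<sigma> n) * G n) \<longlonglongrightarrow> of_real (exp (- t\<^sup>2 / 2))"
      unfolding G_def \<sigma>_def by (rule centred_exponent_tendsto)
    ultimately have "(\<lambda>n. iexp (- t * \<sigma> n) * (A n - G n) + iexp (- t * \<sigma> n) * G n)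
        \<longlonglongrightarrow> 0 + of_real (exp (- t\<^sup>2 / 2))"
      by (rule tendsto_add)
    hence lim: "(\<lambda>n. iexp (- t * \<sigma> n) * A n) \<longlonglongrightarrow> of_real (exp (- t\<^sup>2 / 2))"
      by (simp add: algebra_simps)
    have "eventually (\<lambda>n. 1 \<le> ln (real n)) sequentially" by real_asymp
    hence "eventually (\<lambda>n. iexp (- t * \<sigma> n) * A n = char (M n) t) sequentially"
    proof eventually_elim
      case (elim n)
      have \<sigma>: "\<sigma> n > 0" "ln (real n) = \<sigma> n * \<sigma> n" using elim by (auto simp: \<sigma>_def)
      have "iexp (- t * \<sigma> n) * iexp (t / \<sigma> n) ^ omega1 f = iexp (t * X n f)" for f :: "'a poly"
      proof -
        have "t * X n f = - t * \<sigma> n + real (omega1 f) * (t / \<sigma> n)"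
          using \<sigma> unfolding X_def \<sigma>_def[symmetric] by (simp add: field_simps)
        thus ?thesis
          by (simp only: of_real_add distrib_left exp_add) (simp add: exp_of_nat_mult[symmetric] algebra_simps)
      qed
      thus ?case unfolding char_eq A_def monic_avg_mult_left[symmetric] by simp
    qed
    with lim show ?thesis
      unfolding char_std_normal_distribution by (rule Lim_transform_eventually)
  qed
  hence "weak_conv_m M std_normal_distribution"
    by (intro levy_continuity distr real_dist_normal_dist)
  hence "(\<lambda>n. cdf (M n) a) \<longlonglongrightarrow> cdf std_normal_distribution a"
    using isCont_cdf_std_normal_distribution unfolding weak_conv_m_def weak_conv_def by blast
  moreover have "cdf (M n) a = 1 / real CARD('a) ^ n *
      real (card {f :: 'a poly. f \<in> monic_polys n \<and>
              (real (omega1 f) - ln (real n)) / sqrt (ln (real n)) \<le> a})" for n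
  proof -
    have "cdf (M n) a = measure (measure_pmf (U n)) {f. X n f \<le> a}"
      unfolding cdf_def M_def by (subst measure_distr) (auto simp: vimage_def)
    also have "\<dots> = real (card (monic_polys n \<inter> {f. X n f \<le> a})) / real CARD('a) ^ n"
      unfolding U_def by (subst measure_pmf_of_set) (use ne in \<open>auto simp: card_monic_polys\<close>)
    finally show ?thesis by (simp add: X_def Int_def)
  qed
  ultimately show ?thesis by (simp add: cdf_std_normal_distribution)
qed

end
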